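(* Let $f:\mathbb{R}\to\mathbb{R}$ be a smooth convex function with a unique extreme point (minimizer) $t^*$. Suppose $f$ is strong convex, i.e. there is $\lambda>0$ with $|f^{(1)}(x)-f^{(1)}(y)|\ge\lambda|x-y|$ for all $x,y\in\mathbb{R}$, and satisfies Lipschitz continuous gradient, i.e. there is $\mu>0$ with $|f^{(1)}(x)-f^{(1)}(y)|\le \mu|x-y|$ for all $x,y\in\mathbb{R}$. Let $1<\alpha<2$ and $\rho>0$, and consider the fractional order gradient method $$t_{k+2}=t_{k+1}-\rho f^{(1)}(t_{k+1})\,|t_{k+1}-t_k|^{1-\alpha},\qquad k\ge 1.$$ Then $t_k$ cannot asymptotically converge to the extreme point but only converges to a bounded region of $t^*$: no sequence $(t_k)$ generated by the method satisfies $\lim_{k\to\infty}t_k=t^*$, while there exists a constant $B\ge0$ (independent of the initial points) such that every generated sequence satisfies $\limsup_{k\to\infty}|t_k-t^*|\le B$.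
   Context: $f^{(1)}$ denotes the first derivative of $f$. A sequence generated by the method is an infinite real sequence $(t_k)_{k\ge 1}$, started from real initial points $t_1\neq t_2$, satisfying the recursion for all $k\ge1$. Since $1-\alpha<0$, the recursion only makes sense while $t_{k+1}\ne t_k$; it is assumed that $t_{k+1}\neq t_k$ for all $k$. *)

theory Defs
  imports "HOL-Analysis.Analysis"
begin

definition smooth :: "(real \<Rightarrow> real) \<Rightarrow> bool" where
  "smooth f \<longleftrightarrow> (\<forall>n. (deriv ^^ n) f differentiable_on UNIV)"

definition unique_minimizer :: "(real \<Rightarrow> real) \<Rightarrow> real \<Rightarrow> bool" where
  "unique_minimizer f x \<longleftrightarrow> (\<forall>y. f x \<le> f y) \<and> (\<forall>z. (\<forall>y. f z \<le> f y) \<longrightarrow> z = x)"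

definition strong_convex :: "(real \<Rightarrow> real) \<Rightarrow> bool" where
  "strong_convex f \<longleftrightarrow>
     (\<exists>l>0. \<forall>x y. \<bar>deriv f x - deriv f y\<bar> \<ge> l * \<bar>x - y\<bar>)"

definition lipschitz_gradient :: "(real \<Rightarrow> real) \<Rightarrow> bool" where
  "lipschitz_gradient f \<longleftrightarrow>
     (\<exists>\<mu>>0. \<forall>x y. \<bar>deriv f x - deriv f y\<bar> \<le> \<mu> * \<bar>x - y\<bar>)"

text \<open>Sequences are indexed from 1; the value \<open>t 0\<close> is unconstrained and irrelevant.
  The condition \<open>t (k + 1) \<noteq> t k\<close> (which for \<open>k = 1\<close> says that the two initial points
  differ) keeps the base of the negative power \<open>1 - \<alpha>\<close> positive.\<close>

definition fractional_gradient_sequence ::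
  "(real \<Rightarrow> real) \<Rightarrow> real \<Rightarrow> real \<Rightarrow> (nat \<Rightarrow> real) \<Rightarrow> bool" where
  "fractional_gradient_sequence f \<alpha> \<rho> t \<longleftrightarrow>
     (\<forall>k\<ge>1. t (k + 1) \<noteq> t k) \<and>
     (\<forall>k\<ge>1. t (k + 2) =
        t (k + 1) - \<rho> * deriv f (t (k + 1)) * \<bar>t (k + 1) - t k\<bar> powr (1 - \<alpha>))"

end

theory Submission
  imports Defs
begin

text \<open>With \<open>x\<^sub>k = t\<^sub>k - t\<^sup>*\<close> and \<open>\<beta> = \<alpha> - 1\<close> the method reads
  \<open>x\<^sub>k\<^sub>+\<^sub>2 = (1 - h\<^sub>k D\<^sub>k\<^sup>-\<^sup>\<beta>) x\<^sub>k\<^sub>+\<^sub>1\<close>, where \<open>D\<^sub>k = \<bar>x\<^sub>k\<^sub>+\<^sub>1 - x\<^sub>k\<bar>\<close> and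
  \<open>h\<^sub>k\<close> stays between the positive constants \<open>c = \<rho>\<lambda>\<close> and \<open>C = \<rho>\<mu>\<close>.
  If \<open>x\<^sub>k\<close> tended to \<open>0\<close>, so would \<open>D\<^sub>k\<close>, and the factor would eventually have modulus at
  least \<open>1\<close>, which is absurd.

  Put \<open>M = C\<^bsup>1/\<beta>\<^esup>\<close>. A step with \<open>D\<^sub>k \<ge> M\<close> contracts. A step with \<open>D\<^sub>k < M\<close> may expand, but
  then \<open>D\<^sub>k \<ge> c \<bar>x\<^sub>k\<bar> D\<^sub>k\<^sub>-\<^sub>1\<^sup>-\<^sup>\<beta>\<close> forces \<open>x\<^sub>k\<close> to be of order \<open>D\<^sub>k\<^sub>-\<^sub>1\<^sup>\<beta>\<close>, so that the new
  point is bounded by a function of the earlier ones that grows only like the power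
  \<open>\<beta> < 1\<close>. Hence an eventual bound \<open>s\<close> on \<open>\<bar>x\<^sub>k\<bar>\<close> can be improved to \<open>s / 2\<close> as long as \<open>s\<close>
  exceeds a threshold depending only on \<open>c\<close>, \<open>C\<close> and \<open>\<beta>\<close>.\<close>

section \<open>The abstract recursion and why it cannot tend to zero\<close>

locale step_recursion =
  fixes x h :: "nat \<Rightarrow> real" and c C \<beta> :: real
  assumes c_pos: "0 < c" and \<beta>_pos: "0 < \<beta>" and \<beta>_less_1: "\<beta> < 1"
    and h_ge: "c \<le> h k" and h_le: "h k \<le> C"
    and distinct: "x (Suc k) \<noteq> x k"
    and step: "x (Suc (Suc k)) = x (Suc k) * (1 - h k * \<bar>x (Suc k) - x k\<bar> powr (- \<beta>))"
begin

lemma C_pos: "0 < C"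
  using c_pos h_ge[of 0] h_le[of 0] by linarith

lemma not_tendsto_zero: "\<not> x \<longlonglongrightarrow> 0"
proof
  assume lim: "x \<longlonglongrightarrow> 0"
  \<comment> \<open>\<open>\<delta>\<close> solves \<open>c * \<delta> powr (- \<beta>) = 2\<close>,
    so steps shorter than \<open>\<delta>\<close> give a factor of at most -1.\<close>
  define \<delta> where "\<delta> = (c / 2) powr (1 / \<beta>)"
  have \<delta>: "\<delta> > 0" "\<delta> powr (- \<beta>) = 2 / c"
    using c_pos \<beta>_pos by (simp_all add: \<delta>_def powr_powr powr_minus_divide)
  have "(\<lambda>k. x (Suc k) - x k) \<longlonglongrightarrow> 0 - 0"
    by (intro tendsto_diff lim LIMSEQ_Suc)
  then have "eventually (\<lambda>k. \<bar>x (Suc k) - x k\<bar> < \<delta>) sequentially"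
    using \<delta>(1) by (auto simp: tendsto_iff dist_real_def)
  then obtain N where N: "\<And>k. k \<ge> N \<Longrightarrow> \<bar>x (Suc k) - x k\<bar> < \<delta>"
    by (auto simp: eventually_sequentially)
  have grow: "\<bar>x (Suc k)\<bar> \<le> \<bar>x (Suc (Suc k))\<bar>" if "k \<ge> N" for k
  proof -
    have "2 / c \<le> \<bar>x (Suc k) - x k\<bar> powr (- \<beta>)"
      using N[OF that] distinct[of k] \<beta>_pos unfolding \<delta>(2)[symmetric]
      by (intro powr_mono2') auto
    then have "c * (2 / c) \<le> h k * \<bar>x (Suc k) - x k\<bar> powr (- \<beta>)"
      using c_pos h_ge[of k] by (intro mult_mono) auto
    then have "1 \<le> \<bar>1 - h k * \<bar>x (Suc k) - x k\<bar> powr (- \<beta>)\<bar>"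
      using c_pos by simp
    then show ?thesis
      unfolding step abs_mult using mult_left_mono[of 1 _ "\<bar>x (Suc k)\<bar>"] by fastforce
  qed
  have ge: "\<bar>x (Suc N)\<bar> \<le> \<bar>x (Suc (N + k))\<bar>" for k
    by (induction k) (use grow in \<open>auto intro: order_trans\<close>)
  \<comment> \<open>Once at 0, the recursion would stay there, against
    \<open>distinct\<close>.\<close>
  have "x (Suc N) \<noteq> 0"
    using distinct[of "Suc N"] step[of N] by auto
  moreover have "(\<lambda>k. \<bar>x (Suc (N + k))\<bar>) \<longlonglongrightarrow> 0"
    using LIMSEQ_ignore_initial_segment[OF lim, of "Suc N"]
    by (intro tendsto_rabs_zero) (simp add: add.commute)
  then have "\<bar>x (Suc N)\<bar> \<le> 0"
    using ge by (intro LIMSEQ_le_const) auto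
  ultimately show False by simp
qed

section \<open>Effect of long and short steps\<close>

definition M :: real where "M = C powr (1 / \<beta>)"

text \<open>Will bound the point following a short step, \<open>s\<close> bounding the earlier
  points. Growth like \<open>s powr \<beta>\<close> brings it below \<open>s / 2\<close> for large
  \<open>s\<close>.\<close>

definition \<phi> :: "real \<Rightarrow> real" where "\<phi> s = 2 * M * (1 + (2 * s) powr \<beta> / c)"

lemma M_pos: "M > 0"
  using C_pos by (simp add: M_def)

lemma M_powr: "M powr \<beta> = C"
  using C_pos \<beta>_pos by (simp add: M_def powr_powr)

text \<open>Since \<open>C * M powr (- \<beta>) = 1\<close>, the factor of a long step is
  nonnegative, and \<open>h_ge\<close> then bounds it from above.\<close>

lemma contraction_of_long_step:
  assumes "M \<le> \<bar>x (Suc k) - x k\<bar>"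
  shows "\<bar>x (Suc (Suc k))\<bar> \<le> \<bar>x (Suc k)\<bar> * (1 - c * \<bar>x (Suc k) - x k\<bar> powr (- \<beta>))"
proof -
  let ?p = "\<bar>x (Suc k) - x k\<bar> powr (- \<beta>)"
  have "?p \<le> M powr (- \<beta>)"
    using assms M_pos \<beta>_pos by (intro powr_mono2') auto
  also have "\<dots> = 1 / C"
    by (simp add: powr_minus_divide M_powr)
  finally have "h k * ?p \<le> C * (1 / C)"
    using h_le[of k] C_pos by (intro mult_mono) auto
  then have "\<bar>1 - h k * ?p\<bar> = 1 - h k * ?p"
    using C_pos by simp
  also have "\<dots> \<le> 1 - c * ?p"
    using h_ge[of k] by (simp add: mult_right_mono)
  finally show ?thesis
    unfolding step abs_mult by (rule mult_left_mono) simp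
qed

text \<open>Solving the recursion for \<open>x (Suc k)\<close> bounds it by
  \<open>D * E powr \<beta> / c\<close>, with \<open>D\<close> the short step and \<open>E\<close>
  the one before. The factor \<open>D\<close> then absorbs the singular
  \<open>D powr (- \<beta>)\<close> of the next step.\<close>

lemma bound_of_short_step:
  assumes short: "\<bar>x (Suc (Suc k)) - x (Suc k)\<bar> < M"
    and bound: "\<bar>x k\<bar> \<le> s" "\<bar>x (Suc k)\<bar> \<le> s"
  shows "\<bar>x (Suc (Suc (Suc k)))\<bar> \<le> \<phi> s"
proof -
  define D where "D = \<bar>x (Suc (Suc k)) - x (Suc k)\<bar>"
  define E where "E = \<bar>x (Suc k) - x k\<bar>"
  have D: "0 < D" "D < M" and E: "0 < E" "E \<le> 2 * s"
    using distinct[of "Suc k"] distinct[of k] short bound by (auto simp: D_def E_def)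
  have "x (Suc (Suc k)) - x (Suc k) = - (x (Suc k) * h k * E powr (- \<beta>))"
    by (simp add: step[of k] E_def algebra_simps)
  then have "D = \<bar>x (Suc k)\<bar> * h k * E powr (- \<beta>)"
    using h_ge[of k] c_pos by (simp add: D_def abs_mult)
  then have "D * E powr \<beta> = \<bar>x (Suc k)\<bar> * h k"
    using E by (simp add: powr_minus field_simps)
  also have "\<dots> \<ge> \<bar>x (Suc k)\<bar> * c"
    using h_ge[of k] by (intro mult_left_mono) auto
  finally have 1: "\<bar>x (Suc k)\<bar> \<le> D * E powr \<beta> / c"
    using c_pos by (simp add: field_simps)
  have "\<bar>x (Suc (Suc k))\<bar> \<le> \<bar>x (Suc k)\<bar> + D"
    by (simp add: D_def)
  also have "\<dots> \<le> D * (1 + E powr \<beta> / c)"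
    using 1 by (simp add: algebra_simps)
  also have "\<dots> \<le> D * (1 + (2 * s) powr \<beta> / c)"
    using D E c_pos \<beta>_pos
    by (intro mult_left_mono add_left_mono divide_right_mono powr_mono2) auto
  finally have 2: "\<bar>x (Suc (Suc k))\<bar> \<le> D * (1 + (2 * s) powr \<beta> / c)" .
  have "\<bar>1 - h (Suc k) * D powr (- \<beta>)\<bar> \<le> 1 + h (Suc k) * D powr (- \<beta>)"
    using h_ge[of "Suc k"] c_pos by (intro abs_triangle_ineq4[THEN order_trans]) (simp add: abs_mult)
  also have "\<dots> \<le> 1 + C * D powr (- \<beta>)"
    using h_le by (intro add_left_mono mult_right_mono) auto
  finally have 3: "\<bar>1 - h (Suc k) * D powr (- \<beta>)\<bar> \<le> 1 + C * D powr (- \<beta>)" .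
  \<comment> \<open>The exponent \<open>1 - \<beta>\<close> is positive, so the product is at most
    its value \<open>M / C\<close> at \<open>D = M\<close>.\<close>
  have "D * D powr (- \<beta>) = D powr (1 - \<beta>)"
    using D by (simp add: powr_diff powr_minus field_simps)
  also have "\<dots> \<le> M powr (1 - \<beta>)"
    using D \<beta>_less_1 by (intro powr_mono2) auto
  also have "\<dots> = M / C"
    using M_pos by (simp add: powr_diff M_powr)
  finally have "D * (1 + C * D powr (- \<beta>)) \<le> D + M"
    using C_pos by (simp add: field_simps)
  then have 4: "D * (1 + C * D powr (- \<beta>)) \<le> 2 * M"
    using D by simp
  have "\<bar>x (Suc (Suc (Suc k)))\<bar> = \<bar>x (Suc (Suc k))\<bar> * \<bar>1 - h (Suc k) * D powr (- \<beta>)\<bar>"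
    by (simp add: step[of "Suc k"] D_def abs_mult)
  also have "\<dots> \<le> D * (1 + (2 * s) powr \<beta> / c) * (1 + C * D powr (- \<beta>))"
    using 2 3 D c_pos by (intro mult_mono) auto
  also have "\<dots> = D * (1 + C * D powr (- \<beta>)) * (1 + (2 * s) powr \<beta> / c)"
    by (simp only: mult_ac)
  also have "\<dots> \<le> \<phi> s"
    unfolding \<phi>_def using 4 c_pos by (intro mult_right_mono add_nonneg_nonneg) auto
  finally show ?thesis .
qed

lemma bound_of_step:
  assumes "\<bar>x k\<bar> \<le> s" "\<bar>x (Suc k)\<bar> \<le> s"
  shows "\<bar>x (Suc (Suc (Suc k)))\<bar> \<le> max \<bar>x (Suc (Suc k))\<bar> (\<phi> s)"
proof (cases "\<bar>x (Suc (Suc k)) - x (Suc k)\<bar> < M")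
  case True
  then show ?thesis using bound_of_short_step assms by fastforce
next
  case False
  then have "\<bar>x (Suc (Suc (Suc k)))\<bar> \<le>
      \<bar>x (Suc (Suc k))\<bar> * (1 - c * \<bar>x (Suc (Suc k)) - x (Suc k)\<bar> powr (- \<beta>))"
    by (intro contraction_of_long_step) simp
  also have "\<dots> \<le> \<bar>x (Suc (Suc k))\<bar>"
    using c_pos by (intro mult_left_le) auto
  finally show ?thesis by simp
qed

section \<open>Improvement of eventual bounds down to a uniform threshold\<close>

lemma long_steps_tendsto_zero:
  assumes long: "\<And>k. k \<ge> N \<Longrightarrow> M \<le> \<bar>x (Suc k) - x k\<bar>"
    and bound: "\<And>k. k \<ge> N \<Longrightarrow> \<bar>x k\<bar> \<le> s"
  shows "x \<longlonglongrightarrow> 0"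
proof -
  \<comment> \<open>Points within \<open>s\<close> of 0 are at most \<open>2 * s\<close> apart, so
    \<open>q\<close> bounds all contraction factors at once.\<close>
  define q where "q = 1 - c * (2 * s) powr (- \<beta>)"
  have contr: "\<bar>x (Suc (Suc k))\<bar> \<le> \<bar>x (Suc k)\<bar> * q" if "k \<ge> N" for k
  proof -
    have "(2 * s) powr (- \<beta>) \<le> \<bar>x (Suc k) - x k\<bar> powr (- \<beta>)"
      using bound[of k] bound[of "Suc k"] that distinct[of k] \<beta>_pos
      by (intro powr_mono2') auto
    then have "1 - c * \<bar>x (Suc k) - x k\<bar> powr (- \<beta>) \<le> q"
      using c_pos by (simp add: q_def)
    then show ?thesis
      using contraction_of_long_step[OF long[OF that]]
      by (meson abs_ge_zero mult_left_mono order_trans)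
  qed
  have s: "s > 0"
    using long[of N] bound[of N] bound[of "Suc N"] M_pos by simp
  have "x (Suc N) \<noteq> 0"
    using distinct[of "Suc N"] step[of N] by auto
  \<comment> \<open>A negative \<open>q\<close> would make the absolute value on the left of
    \<open>contr\<close> negative.\<close>
  then have q: "0 \<le> q" "q < 1"
    using contr[of N] s c_pos by (auto simp: q_def) (smt (verit) abs_ge_zero mult_pos_neg)
  have le: "\<bar>x (k + Suc N)\<bar> \<le> \<bar>x (Suc N)\<bar> * q ^ k" for k
  proof (induction k)
    case (Suc k)
    have "\<bar>x (Suc k + Suc N)\<bar> \<le> \<bar>x (k + Suc N)\<bar> * q"
      using contr[of "k + N"] by simp
    also have "\<dots> \<le> \<bar>x (Suc N)\<bar> * q ^ k * q"
      using Suc.IH q by (intro mult_right_mono) auto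
    finally show ?case by (simp add: mult_ac)
  qed simp
  have "(\<lambda>k. \<bar>x (Suc N)\<bar> * q ^ k) \<longlonglongrightarrow> \<bar>x (Suc N)\<bar> * 0"
    using q by (intro tendsto_mult_left LIMSEQ_realpow_zero) auto
  then have "(\<lambda>k. x (k + Suc N)) \<longlonglongrightarrow> 0"
    by (intro Lim_null_comparison[of "\<lambda>k. x (k + Suc N)"]) (use le in auto)
  then show ?thesis by (rule LIMSEQ_offset)
qed

text \<open>Short steps recur, since only long steps from some index on would force convergence to
  0. After a short step the bound \<open>\<phi> s\<close> holds, and \<open>bound_of_step\<close>
  carries it along.\<close>

lemma eventual_bound_improves:
  assumes "eventually (\<lambda>k. \<bar>x k\<bar> \<le> s) sequentially"
  shows "eventually (\<lambda>k. \<bar>x k\<bar> \<le> \<phi> s) sequentially"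
proof -
  obtain N where N: "\<And>k. k \<ge> N \<Longrightarrow> \<bar>x k\<bar> \<le> s"
    using assms by (auto simp: eventually_sequentially)
  \<comment> \<open>Searching from \<open>Suc N\<close> on leaves room for a predecessor
    \<open>j \<ge> N\<close>, whose point enters the short-step bound.\<close>
  obtain k where k: "k \<ge> Suc N" "\<bar>x (Suc k) - x k\<bar> < M"
    using long_steps_tendsto_zero[of "Suc N" s] not_tendsto_zero N by (meson Suc_leD not_le)
  obtain j where j: "k = Suc j" "j \<ge> N"
    using k(1) by (cases k) auto
  have "\<bar>x (i + Suc (Suc (Suc j)))\<bar> \<le> \<phi> s" for i
  proof (induction i)
    case 0
    then show ?case using bound_of_short_step[of j s] k j N by simp
  next
    case (Suc i)
    have "\<bar>x (Suc (Suc (Suc (Suc (i + j)))))\<bar> \<le> max \<bar>x (Suc (Suc (Suc (i + j))))\<bar> (\<phi> s)"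
      using j by (intro bound_of_step N) auto
    then show ?case using Suc.IH by simp
  qed
  then show ?thesis
    unfolding eventually_sequentially by (metis le_add_diff_inverse2)
qed

lemma bounded_of_\<phi>_le:
  assumes "\<And>s. s \<ge> R \<Longrightarrow> \<phi> s \<le> s / 2"
  obtains s where "\<And>k. \<bar>x k\<bar> \<le> s"
proof -
  \<comment> \<open>Three initial points are covered because \<open>bound_of_step\<close> controls
    each point through the three before it.\<close>
  define s where "s = max \<bar>R\<bar> (max \<bar>x 0\<bar> (max \<bar>x (Suc 0)\<bar> \<bar>x (Suc (Suc 0))\<bar>))"
  have "\<bar>R\<bar> \<le> s"
    by (simp only: s_def max.cobounded1)
  then have "R \<le> s" "0 \<le> s"
    by simp_all
  then have \<phi>: "\<phi> s \<le> s"
    using assms[of s] by fastforce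
  have "\<bar>x k\<bar> \<le> s \<and> \<bar>x (Suc k)\<bar> \<le> s \<and> \<bar>x (Suc (Suc k))\<bar> \<le> s" for k
  proof (induction k)
    case 0
    show ?case by (simp only: s_def le_max_iff_disj order_refl simp_thms)
  next
    case (Suc k)
    then have "\<bar>x (Suc (Suc (Suc k)))\<bar> \<le> max \<bar>x (Suc (Suc k))\<bar> (\<phi> s)"
      by (intro bound_of_step) auto
    also have "\<dots> \<le> s"
      using Suc.IH \<phi> by (intro max.boundedI) auto
    finally show ?case using Suc.IH by blast
  qed
  then show thesis using that by blast
qed

text \<open>Each improvement halves the bound; the maximum with \<open>R\<close> keeps it in the
  range of the assumption on \<open>\<phi>\<close>. Finitely many rounds reach
  \<open>R\<close>.\<close>

lemma eventually_bounded_of_\<phi>_le: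
  assumes R: "R > 0" and \<phi>: "\<And>s. s \<ge> R \<Longrightarrow> \<phi> s \<le> s / 2"
  shows "eventually (\<lambda>k. \<bar>x k\<bar> \<le> R) sequentially"
proof -
  obtain s where s: "\<And>k. \<bar>x k\<bar> \<le> s"
    using bounded_of_\<phi>_le[OF \<phi>] by blast
  have ev: "eventually (\<lambda>k. \<bar>x k\<bar> \<le> max R (s / 2 ^ n)) sequentially" for n
  proof (induction n)
    case 0
    then show ?case using s by (auto intro: always_eventually simp: le_max_iff_disj)
  next
    case (Suc n)
    have "\<phi> (max R (s / 2 ^ n)) \<le> max R (s / 2 ^ n) / 2"
      by (intro \<phi>) simp
    also have "\<dots> = max (R / 2) (s / 2 ^ Suc n)"
      by (simp add: max_divide_distrib_right mult.commute)
    also have "\<dots> \<le> max R (s / 2 ^ Suc n)"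
      using R by (intro max.mono) auto
    finally show ?case
      using eventual_bound_improves[OF Suc.IH] by (auto elim: eventually_mono)
  qed
  have "(\<lambda>n. s / 2 ^ n) \<longlonglongrightarrow> 0"
    by (rule LIMSEQ_divide_realpow_zero) simp
  then have "eventually (\<lambda>n. s / 2 ^ n < R) sequentially"
    using R by (rule order_tendstoD)
  then obtain n where "s / 2 ^ n < R"
    by (auto simp: eventually_sequentially)
  then show ?thesis using ev[of n] by (simp add: max_absorb1)
qed

end

text \<open>\<open>R\<close> is fixed before \<open>x\<close> and \<open>h\<close>, which makes the
  final bound independent of the initial points. It exists because \<open>\<phi> s / s\<close> tends
  to 0, as \<open>\<beta> < 1\<close>.\<close>

lemma uniform_eventual_bound:
  fixes c C \<beta> :: real
  assumes "0 < \<beta>" "\<beta> < 1"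
  obtains R where "R > 0"
    "\<And>x h. step_recursion x h c C \<beta> \<Longrightarrow> eventually (\<lambda>k. \<bar>x k\<bar> \<le> R) sequentially"
proof -
  \<comment> \<open>\<open>A\<close> is \<open>2 * M\<close>, and \<open>K\<close> is such that
    \<open>\<phi> s / s = A / s + K * s powr (\<beta> - 1)\<close> for \<open>s > 0\<close>.\<close>
  define A where "A = 2 * C powr (1 / \<beta>)"
  define K where "K = A * 2 powr \<beta> / c"
  have "((\<lambda>s. A / s + K * s powr (\<beta> - 1)) \<longlongrightarrow> 0 + K * 0) at_top"
    using assms
    by (intro tendsto_intros tendsto_neg_powr filterlim_ident tendsto_divide_0[OF tendsto_const]
        filterlim_at_top_imp_at_infinity) auto
  then have "eventually (\<lambda>s. A / s + K * s powr (\<beta> - 1) < 1 / 2) at_top"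
    by (intro order_tendstoD) auto
  then obtain R0 where R0: "\<And>s. s \<ge> R0 \<Longrightarrow> A / s + K * s powr (\<beta> - 1) < 1 / 2"
    by (auto simp: eventually_at_top_linorder)
  define R where "R = max R0 1"
  have le: "A * (1 + (2 * s) powr \<beta> / c) \<le> s / 2" if "s \<ge> R" for s
  proof -
    have s: "s > 0" "s \<ge> R0"
      using that by (auto simp: R_def)
    have "A * (1 + (2 * s) powr \<beta> / c) = s * (A / s + K * s powr (\<beta> - 1))"
      using s by (simp add: K_def powr_mult powr_diff algebra_simps)
    also have "\<dots> \<le> s * (1 / 2)"
      using R0[OF s(2)] s by (intro mult_left_mono) auto
    finally show ?thesis by simp
  qed
  show ?thesis
  proof
    show "R > 0" by (simp add: R_def)
    fix x h
    assume "step_recursion x h c C \<beta>"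
    then interpret step_recursion x h c C \<beta> .
    show "eventually (\<lambda>k. \<bar>x k\<bar> \<le> R) sequentially"
    proof (rule eventually_bounded_of_\<phi>_le[OF \<open>R > 0\<close>])
      show "\<phi> s \<le> s / 2" if "s \<ge> R" for s
        using le[OF that] by (simp add: \<phi>_def M_def A_def)
    qed
  qed
qed

section \<open>From the gradient method to the recursion\<close>

lemma convex_deriv_mult_nonneg:
  fixes f :: "real \<Rightarrow> real"
  assumes "convex_on UNIV f" "f differentiable at y" "\<And>z. f x \<le> f z"
  shows "0 \<le> deriv f y * (y - x)"
proof -
  have "(f has_real_derivative deriv f y) (at y)"
    using assms(2) by (simp add: DERIV_deriv_iff_real_differentiable)
  \<comment> \<open>The tangent at \<open>y\<close> lies below the graph; at the minimizer
    \<open>x\<close> the difference \<open>f x - f y\<close> is at most 0.\<close>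
  then have "f x - f y \<ge> deriv f y * (x - y)"
    by (intro convex_on_imp_above_tangent[OF assms(1), of y]) auto
  with assms(3)[of y] show ?thesis by (simp add: algebra_simps)
qed

lemma deriv_zero_at_minimum:
  fixes f :: "real \<Rightarrow> real"
  assumes "f differentiable at x" "\<And>z. f x \<le> f z"
  shows "deriv f x = 0"
  using assms DERIV_local_min[of f "deriv f x" x 1]
  by (simp add: DERIV_deriv_iff_real_differentiable)

text \<open>\<open>h\<close> is \<open>\<rho>\<close> times the difference quotient of
  \<open>deriv f\<close> between the current point and its zero \<open>z\<close>. The index shift
  drops the unconstrained \<open>t 0\<close>.\<close>

lemma fractional_gradient_sequence_step_recursion:
  assumes t: "fractional_gradient_sequence f \<alpha> \<rho> t"
    and "1 < \<alpha>" "\<alpha> < 2" "\<rho> > 0" "l > 0"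
    and sign: "\<And>y. 0 \<le> deriv f y * (y - z)"
    and lower: "\<And>y. l * \<bar>y - z\<bar> \<le> \<bar>deriv f y\<bar>"
    and upper: "\<And>y. \<bar>deriv f y\<bar> \<le> \<mu> * \<bar>y - z\<bar>"
  shows "step_recursion (\<lambda>k. t (Suc k) - z)
    (\<lambda>k. \<rho> * deriv f (t (Suc (Suc k))) / (t (Suc (Suc k)) - z)) (\<rho> * l) (\<rho> * \<mu>) (\<alpha> - 1)"
proof -
  have distinct: "t (Suc (Suc k)) \<noteq> t (Suc k)" for k
    using t by (simp add: fractional_gradient_sequence_def)
  have rec: "t (Suc (Suc (Suc k))) = t (Suc (Suc k)) -
      \<rho> * deriv f (t (Suc (Suc k))) * \<bar>t (Suc (Suc k)) - t (Suc k)\<bar> powr (1 - \<alpha>)" for k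
    using t unfolding fractional_gradient_sequence_def by (auto dest!: spec[of _ "Suc k"])
  \<comment> \<open>By \<open>upper\<close> the derivative vanishes at \<open>z\<close>, so a visit
    to \<open>z\<close> would make the next two points equal.\<close>
  have nz: "t (Suc (Suc k)) \<noteq> z" for k
    using distinct[of "Suc k"] rec[of k] upper[of z] by auto
  \<comment> \<open>\<open>lower\<close> and \<open>upper\<close> control only moduli; the sign
    condition from convexity turns them into bounds on the quotient.\<close>
  have quot: "deriv f y / (y - z) = \<bar>deriv f y\<bar> / \<bar>y - z\<bar>" for y
    using sign[of y] by (simp add: zero_le_mult_iff zero_le_divide_iff flip: abs_divide)
  have bounds: "l \<le> deriv f y / (y - z)" "deriv f y / (y - z) \<le> \<mu>" if "y \<noteq> z" for y
    unfolding quot using lower[of y] upper[of y] that by (simp_all add: field_simps)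
  show ?thesis
  proof
    fix k
    let ?y = "t (Suc (Suc k))"
    show "\<rho> * l \<le> \<rho> * deriv f ?y / (?y - z)" "\<rho> * deriv f ?y / (?y - z) \<le> \<rho> * \<mu>"
      using bounds[OF nz[of k]] \<open>\<rho> > 0\<close>
      unfolding times_divide_eq_right[symmetric] by (intro mult_left_mono; simp)+
    show "?y - z \<noteq> t (Suc k) - z"
      using distinct by simp
    show "t (Suc (Suc (Suc k))) - z = (?y - z) * (1 - \<rho> * deriv f ?y / (?y - z) *
        \<bar>?y - z - (t (Suc k) - z)\<bar> powr (- (\<alpha> - 1)))"
      using nz[of k] by (simp add: rec[of k] right_diff_distrib)
  qed (use assms in auto)
qed

theorem theorem2:
  fixes f :: "real \<Rightarrow> real" and t_star \<alpha> \<rho> :: real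
  assumes "smooth f"
    and "convex_on UNIV f"
    and "unique_minimizer f t_star"
    and "strong_convex f"
    and "lipschitz_gradient f"
    and "1 < \<alpha>" and "\<alpha> < 2"
    and "\<rho> > 0"
  shows "(\<forall>t. fractional_gradient_sequence f \<alpha> \<rho> t \<longrightarrow> \<not> t \<longlonglongrightarrow> t_star) \<and>
    (\<exists>B\<ge>0. \<forall>t. fractional_gradient_sequence f \<alpha> \<rho> t \<longrightarrow>
       limsup (\<lambda>k. ereal \<bar>t k - t_star\<bar>) \<le> ereal B)"
proof -
  have diff: "f differentiable at y" for y
    using \<open>smooth f\<close>[unfolded smooth_def, rule_format, of 0]
    by (simp add: differentiable_on_def)
  have min: "f t_star \<le> f y" for y
    using assms by (simp add: unique_minimizer_def)
  have zero: "deriv f t_star = 0"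
    by (rule deriv_zero_at_minimum[OF diff min])
  obtain l where l: "l > 0" "\<And>y. l * \<bar>y - t_star\<bar> \<le> \<bar>deriv f y\<bar>"
    using \<open>strong_convex f\<close> zero by (metis diff_zero strong_convex_def)
  obtain \<mu> where \<mu>: "\<And>y. \<bar>deriv f y\<bar> \<le> \<mu> * \<bar>y - t_star\<bar>"
    using \<open>lipschitz_gradient f\<close> zero by (metis diff_zero lipschitz_gradient_def)
  note recursion = fractional_gradient_sequence_step_recursion[OF _ \<open>1 < \<alpha>\<close> \<open>\<alpha> < 2\<close> \<open>\<rho> > 0\<close> l(1)
      convex_deriv_mult_nonneg[OF \<open>convex_on UNIV f\<close> diff min] l(2) \<mu>]
  obtain R where R: "R > 0" "\<And>x h. step_recursion x h (\<rho> * l) (\<rho> * \<mu>) (\<alpha> - 1) \<Longrightarrow>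
      eventually (\<lambda>k. \<bar>x k\<bar> \<le> R) sequentially"
    using uniform_eventual_bound[of "\<alpha> - 1" "\<rho> * l" "\<rho> * \<mu>"] assms by auto
  have "\<not> t \<longlonglongrightarrow> t_star" if "fractional_gradient_sequence f \<alpha> \<rho> t" for t
  proof
    assume "t \<longlonglongrightarrow> t_star"
    then have "(\<lambda>k. t (Suc k) - t_star) \<longlonglongrightarrow> 0"
      by (auto intro: LIM_zero LIMSEQ_Suc)
    with step_recursion.not_tendsto_zero[OF recursion[OF that]] show False by blast
  qed
  moreover have "limsup (\<lambda>k. ereal \<bar>t k - t_star\<bar>) \<le> ereal R"
    if "fractional_gradient_sequence f \<alpha> \<rho> t" for t
  proof (rule Limsup_bounded)
    \<comment> \<open>The bound is known for \<open>t (Suc k)\<close>; an eventual property is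
      insensitive to the shift.\<close>
    show "eventually (\<lambda>k. ereal \<bar>t k - t_star\<bar> \<le> ereal R) sequentially"
      using R(2)[OF recursion[OF that]]
      by (simp add: eventually_sequentially_Suc[of "\<lambda>k. \<bar>t k - t_star\<bar> \<le> R"])
  qed
  ultimately show ?thesis using R(1) by (meson less_imp_le)
qed

end
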